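(* Given a Carnot group $\mathbb G$, there exists a vertical surface $V\subseteq \mathbb G$ such that for every vertical subgroup $\mathbb W$ of codimension $1$ in $\mathbb G$ there exists $p\in V$ such that $T_p^{\rm I}V=\mathbb W$.
   Context: A Carnot group $\mathbb G$ is a simply connected nilpotent Lie group whose Lie algebra has a stratification $\mathfrak g=V_1\oplus\dots\oplus V_s$ with $V_{i+1}=[V_1,V_i]$, $V_s\ne\{0\}$, $[V_1,V_s]=\{0\}$. Let $m=\dim V_1$, $n=\dim\mathfrak g$, and let $(X_1,\dots,X_n)$ be a basis of $\mathfrak g$ adapted to the stratification; $\mathbb G$ is identified with $\mathbb R^n$ via $(x_1,\dots,x_n)\mapsto\exp(\sum x_iX_i)$, and $X_i$ also denotes the corresponding left-invariant vector field. A vertical surface is a set $V=\{x\in\mathbb G\equiv\mathbb R^n:f(x_1,\dots,x_m)=0\}$, where $f:\Omega\subseteq\mathbb R^m\to\mathbb R$, $\Omega$ open, is a $C^1$ function with $\nabla f\ne0$ on $\{\omega\in\Omega:f(\omega)=0\}$. If $f$ is linear (on $\mathbb R^m$), $V$ is called a vertical subgroup of codimension $1$. For $p\in V$ the tangent group of $V$ at $p$ is $T_p^{\rm I}V=\{v\in\mathbb G\equiv\mathbb R^n:\sum_{i=1}^mv_i\,X_if(p)=0\}$, where $f$ is regarded as a function on $\mathbb G$ depending only on the first $m$ coordinates. *)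

theory Defs
  imports "HOL-Analysis.Analysis" "HOL-Algebra.Group"
begin

text \<open>
  Carnot groups in exponential coordinates of the first kind: the underlying manifold is
  \<open>real ^ 'n\<close>, with one index in \<open>'n\<close> for each element of the adapted basis
  \<open>(X\<^sub>i)\<close>. It is simply connected, and it serves at the same time as the tangent space at the
  identity, that is, as the Lie algebra.
\<close>

subsection \<open>Functions of class \<open>C\<^sup>k\<close>\<close>

fun Ck_on :: "nat \<Rightarrow> 'a::real_normed_vector set \<Rightarrow> ('a \<Rightarrow> 'b::real_normed_vector) \<Rightarrow> bool" where
  "Ck_on 0 S f \<longleftrightarrow> continuous_on S f"
| "Ck_on (Suc k) S f \<longleftrightarrow> (\<forall>x\<in>S. f differentiable (at x)) \<and>
     (\<forall>v. Ck_on k S (\<lambda>x. frechet_derivative f (at x) v))"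

text \<open>The recursion is only meaningful on open sets, and in finite dimensional domains.\<close>

definition smooth :: "('a::euclidean_space \<Rightarrow> 'b::real_normed_vector) \<Rightarrow> bool" where
  "smooth f \<longleftrightarrow> (\<forall>k. Ck_on k UNIV f)"

definition gradient :: "(real ^ 'm \<Rightarrow> real) \<Rightarrow> real ^ 'm \<Rightarrow> real ^ 'm" where
  "gradient f x = (\<chi> j. frechet_derivative f (at x) (axis j 1))"

subsection \<open>Lie groups whose manifold is \<open>real ^ 'n\<close>\<close>

definition lie_group :: "(real ^ 'n) monoid \<Rightarrow> bool" where
  "lie_group G \<longleftrightarrow> group G \<and> carrier G = UNIV \<and>
     smooth (\<lambda>(x, y). x \<otimes>\<^bsub>G\<^esub> y) \<and> smooth (m_inv G)"

definition left_invariant_field :: "(real ^ 'n) monoid \<Rightarrow> real ^ 'n \<Rightarrow> real ^ 'n \<Rightarrow> real ^ 'n" where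
  "left_invariant_field G v x = frechet_derivative (\<lambda>y. x \<otimes>\<^bsub>G\<^esub> y) (at \<one>\<^bsub>G\<^esub>) v"

definition field_bracket ::
  "('a::real_normed_vector \<Rightarrow> 'a) \<Rightarrow> ('a \<Rightarrow> 'a) \<Rightarrow> 'a \<Rightarrow> 'a" where
  "field_bracket X Y x = frechet_derivative Y (at x) (X x) - frechet_derivative X (at x) (Y x)"

definition lie_bracket :: "(real ^ 'n) monoid \<Rightarrow> real ^ 'n \<Rightarrow> real ^ 'n \<Rightarrow> real ^ 'n" where
  "lie_bracket G u v =
     field_bracket (left_invariant_field G u) (left_invariant_field G v) \<one>\<^bsub>G\<^esub>"

definition bracket_span ::
  "(real ^ 'n) monoid \<Rightarrow> (real ^ 'n) set \<Rightarrow> (real ^ 'n) set \<Rightarrow> (real ^ 'n) set" where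
  "bracket_span G A B = span {lie_bracket G x y |x y. x \<in> A \<and> y \<in> B}"

fun lower_central_series :: "(real ^ 'n) monoid \<Rightarrow> nat \<Rightarrow> (real ^ 'n) set" where
  "lower_central_series G 0 = UNIV"
| "lower_central_series G (Suc k) = bracket_span G UNIV (lower_central_series G k)"

text \<open>Since the group is connected, nilpotency can be read off from its Lie algebra.\<close>

definition nilpotent :: "(real ^ 'n) monoid \<Rightarrow> bool" where
  "nilpotent G \<longleftrightarrow> (\<exists>k. lower_central_series G k = {0})"

text \<open>
  The curve \<open>t \<mapsto> t v\<close> has velocity \<open>v\<close> at \<open>0\<close>; so it being a one-parameter subgroup for every
  \<open>v\<close> says precisely that the exponential map is the identity of \<open>real ^ 'n\<close>. In particular
  the identity element is \<open>0\<close>.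
\<close>

definition exponential_coordinates :: "(real ^ 'n) monoid \<Rightarrow> bool" where
  "exponential_coordinates G \<longleftrightarrow>
     (\<forall>v s t. (s *\<^sub>R v) \<otimes>\<^bsub>G\<^esub> (t *\<^sub>R v) = (s + t) *\<^sub>R v)"

subsection \<open>Carnot groups\<close>

definition direct_sum :: "(nat \<Rightarrow> (real ^ 'n) set) \<Rightarrow> nat \<Rightarrow> bool" where
  "direct_sum V s \<longleftrightarrow> (\<forall>k\<in>{1..s}. subspace (V k)) \<and>
     (\<forall>x. \<exists>!u. (\<forall>k\<in>{1..s}. u k \<in> V k) \<and> (\<forall>k. k \<notin> {1..s} \<longrightarrow> u k = 0) \<and>
            x = (\<Sum>k=1..s. u k))"

definition stratification :: "(real ^ 'n) monoid \<Rightarrow> (nat \<Rightarrow> (real ^ 'n) set) \<Rightarrow> nat \<Rightarrow> bool" where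
  "stratification G V s \<longleftrightarrow> 1 \<le> s \<and> direct_sum V s \<and>
     (\<forall>k. 1 \<le> k \<and> k < s \<longrightarrow> V (Suc k) = bracket_span G (V 1) (V k)) \<and>
     V s \<noteq> {0} \<and> bracket_span G (V 1) (V s) = {0}"

text \<open>
  In exponential coordinates \<open>X\<^sub>i\<close> is the vector \<open>axis i 1\<close>, so adaptedness concerns the standard
  basis. The index type \<open>'n\<close> is not ordered; \<open>hor\<close> enumerates by \<open>'m\<close> the indices of the basis
  vectors lying in \<open>V 1\<close>, which are the ``first \<open>m\<close>'' ones. Thus \<open>CARD('m) = dim (V 1)\<close>.
\<close>

definition adapted :: "(nat \<Rightarrow> (real ^ 'n) set) \<Rightarrow> nat \<Rightarrow> ('m::finite \<Rightarrow> 'n) \<Rightarrow> bool" where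
  "adapted V s hor \<longleftrightarrow>
     (\<forall>k\<in>{1..s}. V k = span {axis i 1 |i. axis i 1 \<in> V k}) \<and>
     inj hor \<and> range hor = {i. axis i 1 \<in> V 1}"

definition carnot_group ::
  "(real ^ 'n) monoid \<Rightarrow> (nat \<Rightarrow> (real ^ 'n) set) \<Rightarrow> nat \<Rightarrow> ('m::finite \<Rightarrow> 'n) \<Rightarrow> bool" where
  "carnot_group G V s hor \<longleftrightarrow> lie_group G \<and> nilpotent G \<and> stratification G V s \<and>
     exponential_coordinates G \<and> adapted V s hor"

subsection \<open>Vertical surfaces\<close>

definition hproj :: "('m \<Rightarrow> 'n) \<Rightarrow> real ^ 'n \<Rightarrow> real ^ 'm" where
  "hproj hor x = (\<chi> j. x $ hor j)"

definition vertical_surface ::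
  "('m::finite \<Rightarrow> 'n::finite) \<Rightarrow> (real ^ 'm) set \<Rightarrow> (real ^ 'm \<Rightarrow> real) \<Rightarrow> (real ^ 'n) set \<Rightarrow> bool" where
  "vertical_surface hor \<Omega> f S \<longleftrightarrow> open \<Omega> \<and> Ck_on 1 \<Omega> f \<and>
     (\<forall>\<omega>\<in>\<Omega>. f \<omega> = 0 \<longrightarrow> gradient f \<omega> \<noteq> 0) \<and>
     S = {x. hproj hor x \<in> \<Omega> \<and> f (hproj hor x) = 0}"

definition vertical_subgroup :: "('m::finite \<Rightarrow> 'n::finite) \<Rightarrow> (real ^ 'n) set \<Rightarrow> bool" where
  "vertical_subgroup hor W \<longleftrightarrow> (\<exists>f. linear f \<and> vertical_surface hor UNIV f W)"

definition tangent_group ::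
  "(real ^ 'n) monoid \<Rightarrow> ('m::finite \<Rightarrow> 'n) \<Rightarrow> (real ^ 'm \<Rightarrow> real) \<Rightarrow> real ^ 'n \<Rightarrow> (real ^ 'n) set" where
  "tangent_group G hor f p =
     {v. (\<Sum>j\<in>UNIV. v $ hor j * frechet_derivative (f \<circ> hproj hor) (at p)
                                   (left_invariant_field G (axis (hor j) 1) p)) = 0}"

end

theory Submission
  imports Defs
begin

text \<open>
  The surface is a small sphere \<open>\<bar>\<omega>\<bar> = r\<close> in the horizontal variables. At \<open>p\<close> its
  horizontal normal has components \<open>2 \<pi>(p) \<bullet> \<pi>(X\<^sub>j(p))\<close>, where \<open>\<pi>\<close> is the horizontal
  projection. Since \<open>X\<^sub>j(p)\<close> depends continuously on \<open>p\<close> and is the \<open>j\<close>-th basis vector at the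
  identity \<open>0\<close>, for small \<open>r\<close> the normal is a small perturbation of \<open>2 \<pi>(p)\<close>, and Brouwer's
  theorem shows that it still attains every direction. This bypasses the fact
  that the horizontal projection is a group homomorphism, which would give the unit sphere.
\<close>

text \<open>Taking \<open>s = t = 0\<close> shows that \<open>0\<close> is idempotent, and the
  identity is the only idempotent of a group.\<close>

lemma one_eq_zero_if_exponential_coordinates:
  assumes "lie_group G" "exponential_coordinates G"
  shows "\<one>\<^bsub>G\<^esub> = 0"
proof -
  interpret group G using assms(1) by (simp add: lie_group_def)
  have "0 \<in> carrier G" using assms(1) by (simp add: lie_group_def)
  moreover have "0 \<otimes>\<^bsub>G\<^esub> 0 = 0"
    using assms(2)[unfolded exponential_coordinates_def, rule_format, of 0 0 0] by simp
  ultimately show ?thesis using l_cancel_one[of 0 0] by simp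
qed

lemma left_invariant_field_one:
  assumes "lie_group G"
  shows "left_invariant_field G v \<one>\<^bsub>G\<^esub> = v"
proof -
  interpret group G using assms by (simp add: lie_group_def)
  have "(\<lambda>y. \<one>\<^bsub>G\<^esub> \<otimes>\<^bsub>G\<^esub> y) = (\<lambda>y. y)"
    using assms by (simp add: lie_group_def fun_eq_iff)
  then show ?thesis by (simp add: left_invariant_field_def frechet_derivative_ident)
qed

lemma Ck_on_1_iff:
  "Ck_on 1 S f \<longleftrightarrow> (\<forall>x\<in>S. f differentiable (at x)) \<and>
     (\<forall>v. continuous_on S (\<lambda>x. frechet_derivative f (at x) v))"
  unfolding One_nat_def Ck_on.simps ..

lemma continuous_on_left_invariant_field:
  assumes "lie_group G"
  shows "continuous_on UNIV (left_invariant_field G v)"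
proof -
  let ?m = "\<lambda>(x, y). x \<otimes>\<^bsub>G\<^esub> y"
  have "Ck_on 1 UNIV ?m" using assms by (simp only: lie_group_def smooth_def)
  then have diff: "?m differentiable (at z)"
    and cont: "continuous_on UNIV (\<lambda>z. frechet_derivative ?m (at z) w)" for z w
    unfolding Ck_on_1_iff by (simp_all del: split_paired_All)
  have eq: "left_invariant_field G v x = frechet_derivative ?m (at (x, \<one>\<^bsub>G\<^esub>)) (0, v)" for x
  proof -
    have m: "(?m has_derivative frechet_derivative ?m (at (x, \<one>\<^bsub>G\<^esub>))) (at (x, \<one>\<^bsub>G\<^esub>))"
      using diff frechet_derivative_works by blast
    have P: "(Pair x has_derivative Pair 0) (at \<one>\<^bsub>G\<^esub>)"
      by (intro has_derivative_Pair has_derivative_const has_derivative_ident)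
    have "(?m \<circ> Pair x has_derivative frechet_derivative ?m (at (x, \<one>\<^bsub>G\<^esub>)) \<circ> Pair 0)
        (at \<one>\<^bsub>G\<^esub>)"
      by (rule diff_chain_at[OF P m])
    then have "frechet_derivative ?m (at (x, \<one>\<^bsub>G\<^esub>)) \<circ> Pair 0
        = frechet_derivative (?m \<circ> Pair x) (at \<one>\<^bsub>G\<^esub>)"
      by (rule frechet_derivative_at)
    then show ?thesis by (simp add: left_invariant_field_def o_def fun_eq_iff)
  qed
  have "continuous_on UNIV (\<lambda>x. (x, \<one>\<^bsub>G\<^esub>))"
    by (intro continuous_on_Pair continuous_on_id continuous_on_const)
  then have "continuous_on UNIV (\<lambda>x. frechet_derivative ?m (at (x, \<one>\<^bsub>G\<^esub>)) (0, v))"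
    by (rule continuous_on_compose2[OF cont]) simp
  then show ?thesis by (simp only: eq[abs_def])
qed

text \<open>Freezing the frame along rays extends the map
  \<open>w \<mapsto> (\<chi> j. w \<bullet> E w j)\<close> from the sphere of radius
  \<open>r\<close> to a positively homogeneous map \<open>H\<close> of nonzero vectors. For small
  \<open>r\<close>, \<open>H\<close> is so close to the identity near the unit vector
  \<open>a\<close> that it attains \<open>a\<close>; rescaling the preimage to norm \<open>r\<close>
  only multiplies the value by a positive factor.\<close>

lemma near_identity_frame_attains_directions:
  fixes E :: "real ^ 'm \<Rightarrow> 'm \<Rightarrow> real ^ 'm"
  assumes cont: "\<And>j. continuous_on UNIV (\<lambda>w. E w j)"
    and E0: "\<And>j. E 0 j = axis j 1"
  shows "\<exists>r>0. \<forall>a. norm a = 1 \<longrightarrow>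
    (\<exists>w c. norm w = r \<and> c \<noteq> 0 \<and> (\<chi> j. w \<bullet> E w j) = c *\<^sub>R a)"
proof -
  let ?g = "\<lambda>w. \<Sum>j\<in>UNIV. norm (E w j - axis j 1)"
  have "continuous_on UNIV ?g" by (intro continuous_intros cont)
  then have "isCont ?g 0" by (simp add: continuous_on_eq_continuous_at)
  \<comment> \<open>The bound \<open>1/3\<close> is chosen so that, with
    \<open>norm y \<le> 3/2\<close> on the ball of radius \<open>1/2\<close> about a unit vector,
    the total error is at most \<open>3/2 * (1/3) = 1/2\<close>, the radius of the ball.\<close>
  then have "\<exists>d>0. \<forall>w. dist w 0 < d \<longrightarrow> dist (?g w) (?g 0) < 1/3"
    unfolding continuous_at_eps_delta by (elim allE[of _ "1/3"]) simp
  then obtain d where "d > 0" and d: "\<And>w. dist w 0 < d \<Longrightarrow> dist (?g w) (?g 0) < 1/3"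
    by blast
  define r where "r = d / 2"
  have "r > 0" using \<open>d > 0\<close> by (simp add: r_def)
  have small: "?g w \<le> 1/3" if "norm w = r" for w
    using d[of w] that \<open>d > 0\<close> by (simp add: E0 r_def dist_norm)
  have "\<exists>w c. norm w = r \<and> c \<noteq> 0 \<and> (\<chi> j. w \<bullet> E w j) = c *\<^sub>R a" if a: "norm a = 1" for a
  proof -
    \<comment> \<open>Radial projection onto the sphere of radius \<open>r\<close>; the ball about
      \<open>a\<close> used below avoids its singularity at \<open>0\<close>.\<close>
    define s where "s y = (r / norm y) *\<^sub>R y" for y :: "real ^ 'm"
    define H where "H y = (\<chi> j. y \<bullet> E (s y) j)" for y
    have nz: "y \<noteq> 0" if "y \<in> cball a (1/2)" for y
      using that a by auto
    have ny: "norm y \<le> 3/2" if "y \<in> cball a (1/2)" for y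
      using that a norm_triangle_ineq2[of y a] by (simp add: dist_norm norm_minus_commute)
    have ns: "norm (s y) = r" if "y \<noteq> 0" for y
      using that \<open>r > 0\<close> by (simp add: s_def)
    have near: "norm (y - H y) \<le> 1/2" if y: "y \<in> cball a (1/2)" for y
    proof -
      have "norm (y - H y) \<le> (\<Sum>j\<in>UNIV. \<bar>(y - H y) $ j\<bar>)" by (rule norm_le_l1_cart)
      also have "\<dots> \<le> (\<Sum>j\<in>UNIV. norm y * norm (E (s y) j - axis j 1))"
      proof (rule sum_mono)
        fix j
        have "\<bar>(y - H y) $ j\<bar> = \<bar>y \<bullet> (E (s y) j - axis j 1)\<bar>"
          by (simp add: H_def inner_diff_right inner_axis)
        also have "\<dots> \<le> norm y * norm (E (s y) j - axis j 1)" by (rule Cauchy_Schwarz_ineq2)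
        finally show "\<bar>(y - H y) $ j\<bar> \<le> norm y * norm (E (s y) j - axis j 1)" .
      qed
      also have "\<dots> = norm y * ?g (s y)" by (simp add: sum_distrib_left)
      also have "\<dots> \<le> 3/2 * (1/3)"
        using ny[OF y] small[OF ns[OF nz[OF y]]] by (intro mult_mono) (auto intro: sum_nonneg)
      finally show ?thesis by simp
    qed
    have "continuous_on (cball a (1/2)) s"
      unfolding s_def using nz by (auto intro!: continuous_intros)
    then have "continuous_on (cball a (1/2)) (\<lambda>y. E (s y) j)" for j
      by (rule continuous_on_compose2[OF cont]) simp
    then have "continuous_on (cball a (1/2)) H"
      unfolding H_def by (intro continuous_intros)
    \<comment> \<open>A fixed point of \<open>y \<mapsto> a + (y - H y)\<close> solves
      \<open>H y = a\<close>, so Brouwer needs this map to send the ball into itself.\<close>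
    moreover have "x + (y - H y) \<in> cball a (1/2)" if "x \<in> {a}" "y \<in> cball a (1/2)" for x y
      using that near[of y] by (simp add: dist_norm norm_minus_commute)
    ultimately obtain y where y: "y \<in> cball a (1/2)" "H y = a"
      using brouwer_surjective_cball[where e = "1/2" and a = a and f = H and S = "{a}" and x = a] by auto
    have "(\<chi> j. s y \<bullet> E (s y) j) = (r / norm y) *\<^sub>R a"
      using arg_cong[OF y(2), of "\<lambda>x. (r / norm y) *\<^sub>R x"]
      by (simp add: s_def H_def vec_eq_iff)
    then show ?thesis
      using ns[OF nz[OF y(1)]] nz[OF y(1)] \<open>r > 0\<close> by (intro exI[of _ "s y"] exI[of _ "r / norm y"]) auto
  qed
  with \<open>r > 0\<close> show ?thesis by auto
qed

lemma linear_hproj: "linear (hproj hor)"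
  by (rule linearI) (simp_all add: hproj_def vec_eq_iff)

lemma hproj_axis: "inj hor \<Longrightarrow> hproj hor (axis (hor j) 1) = axis j 1"
  by (auto simp: hproj_def vec_eq_iff axis_def inj_eq)

text \<open>Provides a right inverse of \<open>hproj hor\<close>. At an index outside
  \<open>range hor\<close> the coordinate is some unspecified entry of \<open>w\<close>, which
  \<open>hproj\<close> never reads.\<close>

lemma hproj_inv_into:
  assumes "inj hor"
  shows "hproj hor (\<chi> i. w $ inv_into UNIV hor i) = w"
  using assms by (simp add: hproj_def vec_eq_iff)

lemma vertical_subgroupD:
  assumes "vertical_subgroup hor W"
  obtains a where "norm a = 1" "W = {x. a \<bullet> hproj hor x = 0}"
proof -
  obtain g where lin: "linear g" and "vertical_surface hor UNIV g W"
    using assms by (auto simp: vertical_subgroup_def)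
  then have grad: "gradient g 0 \<noteq> 0" and W: "W = {x. g (hproj hor x) = 0}"
    by (auto simp: vertical_surface_def linear_0)
  \<comment> \<open>The Riesz representative of the functional \<open>g\<close>. It is nonzero
    because \<open>0\<close> is a zero of \<open>g\<close>, where the gradient must not vanish;
    normalising it keeps the zero set.\<close>
  define b where "b = adjoint g 1"
  have g: "g x = b \<bullet> x" for x
    using adjoint_works[OF lin, of x 1] by (simp add: b_def inner_commute)
  have "frechet_derivative g (at 0) = g"
    using frechet_derivative_at[OF linear_imp_has_derivative[OF lin, of "at 0"]] by simp
  with grad g have "b \<noteq> 0" by (auto simp: gradient_def vec_eq_iff inner_axis)
  then show ?thesis using that[of "sgn b"] by (simp add: norm_sgn W g sgn_div_norm)
qed

lemma has_derivative_inner_self: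
  "((\<lambda>w. w \<bullet> w - c) has_derivative (\<lambda>h. 2 * (w \<bullet> h))) (at w)"
  by (auto intro!: derivative_eq_intros simp: inner_commute)

lemma frechet_derivative_inner_self:
  "frechet_derivative (\<lambda>w. w \<bullet> w - c) (at w) = (\<lambda>h. 2 * (w \<bullet> h))"
  by (rule frechet_derivative_at[OF has_derivative_inner_self, symmetric])

text \<open>Positivity of \<open>r\<close> enters twice: it turns
  \<open>w \<bullet> w = r\<^sup>2\<close> into \<open>norm w = r\<close>, and it keeps the gradient
  \<open>2 *\<^sub>R w\<close> nonzero on the sphere.\<close>

lemma vertical_surface_sphere:
  fixes hor :: "'m::finite \<Rightarrow> 'n::finite"
  assumes "r > 0"
  shows "vertical_surface hor UNIV (\<lambda>w. w \<bullet> w - r\<^sup>2) {x. norm (hproj hor x) = r}"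
proof -
  let ?f = "\<lambda>w :: real ^ 'm. w \<bullet> w - r\<^sup>2"
  have zero: "?f w = 0 \<longleftrightarrow> norm w = r" for w
    using assms by (simp add: dot_square_norm)
  have "Ck_on 1 UNIV ?f"
    using has_derivative_inner_self
    by (auto simp: Ck_on_1_iff frechet_derivative_inner_self differentiable_def intro!: continuous_intros)
  moreover have "gradient ?f w = 2 *\<^sub>R w" for w
    by (simp add: gradient_def frechet_derivative_inner_self inner_axis vec_eq_iff)
  ultimately show ?thesis
    using assms zero by (auto simp: vertical_surface_def)
qed

text \<open>By the chain rule the derivative at \<open>p\<close> is
  \<open>2 * (hproj hor p \<bullet> hproj hor h)\<close>; the factor \<open>2\<close> does not
  affect the hyperplane.\<close>

lemma tangent_group_sphere:
  "tangent_group G hor (\<lambda>w. w \<bullet> w - c) p =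
     {v. (\<chi> j. hproj hor p \<bullet> hproj hor (left_invariant_field G (axis (hor j) 1) p)) \<bullet> hproj hor v = 0}"
proof -
  have "((\<lambda>w. w \<bullet> w - c) \<circ> hproj hor has_derivative
      (\<lambda>h. 2 * (hproj hor p \<bullet> h)) \<circ> hproj hor) (at p)"
    by (rule diff_chain_at[OF linear_imp_has_derivative[OF linear_hproj]
        has_derivative_inner_self])
  then have "frechet_derivative ((\<lambda>w. w \<bullet> w - c) \<circ> hproj hor) (at p)
      = (\<lambda>h. 2 * (hproj hor p \<bullet> hproj hor h))"
    by (auto simp: o_def dest: frechet_derivative_at)
  moreover have "(\<Sum>j\<in>UNIV. v $ hor j * (2 * n j)) = 2 * ((\<chi> j. n j) \<bullet> hproj hor v)" for v n
    by (simp add: inner_vec_def hproj_def sum_distrib_left mult_ac)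
  ultimately show ?thesis by (simp add: tangent_group_def)
qed

theorem lemma2p27:
  fixes G :: "(real ^ 'n::finite) monoid"
    and V :: "nat \<Rightarrow> (real ^ 'n) set" and s :: nat
    and hor :: "'m::finite \<Rightarrow> 'n"
  assumes "carnot_group G V s hor"
  shows "\<exists>S \<Omega> f. vertical_surface hor \<Omega> f S \<and>
           (\<forall>W. vertical_subgroup hor W \<longrightarrow> (\<exists>p\<in>S. tangent_group G hor f p = W))"
proof -
  have G: "lie_group G" "exponential_coordinates G" and inj: "inj hor"
    using assms by (auto simp: carnot_group_def adapted_def)
  \<comment> \<open>Whatever the unspecified coordinates are, each is an entry of \<open>w\<close>,
    so \<iota> is continuous and sends \<open>0\<close> to \<open>0\<close>, the identity of
    \<open>G\<close>.\<close>
  define \<iota> where "\<iota> w = (\<chi> i. w $ inv_into UNIV hor i)" for w :: "real ^ 'm"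
  have \<iota>: "hproj hor (\<iota> w) = w" for w
    unfolding \<iota>_def by (rule hproj_inv_into[OF inj])
  define E where "E w j = hproj hor (left_invariant_field G (axis (hor j) 1) (\<iota> w))" for w j
  have "continuous_on UNIV \<iota>"
    unfolding \<iota>_def by (intro continuous_intros)
  then have "continuous_on UNIV (\<lambda>w. E w j)" for j
    unfolding E_def
    by (intro linear_continuous_on_compose[OF _ linear_hproj]
        continuous_on_compose2[OF continuous_on_left_invariant_field[OF G(1)]]) simp_all
  moreover have "E 0 j = axis j 1" for j
  proof -
    have "\<iota> 0 = \<one>\<^bsub>G\<^esub>"
      by (simp add: \<iota>_def vec_eq_iff one_eq_zero_if_exponential_coordinates[OF G])
    then show ?thesis
      by (simp add: E_def left_invariant_field_one[OF G(1)] hproj_axis[OF inj])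
  qed
  ultimately have "\<exists>r>0. \<forall>a. norm a = 1 \<longrightarrow>
      (\<exists>w c. norm w = r \<and> c \<noteq> 0 \<and> (\<chi> j. w \<bullet> E w j) = c *\<^sub>R a)"
    by (rule near_identity_frame_attains_directions)
  then obtain r where "r > 0" and r: "\<And>a. norm a = 1 \<Longrightarrow>
      \<exists>w c. norm w = r \<and> c \<noteq> 0 \<and> (\<chi> j. w \<bullet> E w j) = c *\<^sub>R a"
    by blast
  have "\<exists>p\<in>{x. norm (hproj hor x) = r}. tangent_group G hor (\<lambda>w. w \<bullet> w - r\<^sup>2) p = W"
    if W: "vertical_subgroup hor W" for W
  proof -
    obtain a where a: "norm a = 1" "W = {x. a \<bullet> hproj hor x = 0}"
      using W by (rule vertical_subgroupD)
    obtain w c where w: "norm w = r" "c \<noteq> 0" "(\<chi> j. w \<bullet> E w j) = c *\<^sub>R a"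
      using r[OF a(1)] by blast
    \<comment> \<open>The normal at \<open>\<iota> w\<close> is \<open>c *\<^sub>R a\<close> up to
      the factor \<open>2\<close>; since \<open>c \<noteq> 0\<close>, it has the same orthogonal
      hyperplane as \<open>a\<close>.\<close>
    have "tangent_group G hor (\<lambda>w. w \<bullet> w - r\<^sup>2) (\<iota> w) = W"
      using w(2,3) by (simp add: tangent_group_sphere \<iota> E_def a(2))
    with w(1) show ?thesis by (intro bexI[of _ "\<iota> w"]) (simp_all add: \<iota>)
  qed
  with vertical_surface_sphere[OF \<open>r > 0\<close>, of hor] show ?thesis by blast
qed

end
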